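(* Let $X$ be a finite set of alternatives with $|X|=m\geq 3$ and let $N=\{1,\dots,n\}$ with $n\geq 2$ even. The range of the Borda correspondence $G_B$ on $L(X)^N$ consists of all non-empty subsets of $X$; that is, for every non-empty $S\subseteq X$ there is a profile $u\in L(X)^N$ with $G_B(u)=S$.
   Context: $L(X)$ is the set of strong orderings on $X$: complete (any two distinct alternatives are comparable), asymmetric, transitive relations. A profile is $u=(u(1),\dots,u(n))\in L(X)^N$. The range of a correspondence $G$ from $L(X)^N$ to non-empty subsets of $X$ is the collection of all sets $S$ such that $G(u)=S$ for some profile $u$. Let $s(x,i,u)$ be the rank of $x$ in $u(i)$ (the top-ranked alternative has rank $1$, the bottom-ranked has rank $m$). The Borda score is $B(x,u)=\sum_{i\in N}s(x,i,u)$, and $G_B(u)=\{x\in X: B(x,u)\leq B(y,u)\text{ for all }y\in X\}$. *)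

theory Defs
  imports Main "HOL-Library.FuncSet"
begin

text \<open>
  A strong ordering is a relation \<open>r\<close> on \<open>X\<close>, where \<open>(x, y) \<in> r\<close> means that \<open>x\<close> is ranked
  strictly above \<open>y\<close>.
\<close>

definition strong_orderings :: "'a set \<Rightarrow> 'a rel set" where
  "strong_orderings X = {r. r \<subseteq> X \<times> X \<and> total_on X r \<and> asym r \<and> trans r}"

definition profiles :: "'a set \<Rightarrow> nat set \<Rightarrow> (nat \<Rightarrow> 'a rel) set" where
  "profiles X N = N \<rightarrow>\<^sub>E strong_orderings X"

definition correspondence_range ::
  "'a set \<Rightarrow> nat set \<Rightarrow> ((nat \<Rightarrow> 'a rel) \<Rightarrow> 'a set) \<Rightarrow> 'a set set" where
  "correspondence_range X N G = {S. \<exists>u \<in> profiles X N. G u = S}"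

text \<open>Position counted from the top: the best alternative has rank 1.\<close>

definition position :: "'a set \<Rightarrow> 'a \<Rightarrow> nat \<Rightarrow> (nat \<Rightarrow> 'a rel) \<Rightarrow> nat" where
  "position X x i u = card {y \<in> X. (y, x) \<in> u i} + 1"

definition borda_score :: "'a set \<Rightarrow> nat set \<Rightarrow> 'a \<Rightarrow> (nat \<Rightarrow> 'a rel) \<Rightarrow> nat" where
  "borda_score X N x u = (\<Sum>i\<in>N. position X x i u)"

definition borda :: "'a set \<Rightarrow> nat set \<Rightarrow> (nat \<Rightarrow> 'a rel) \<Rightarrow> 'a set" where
  "borda X N u = {x \<in> X. \<forall>y\<in>X. borda_score X N x u \<le> borda_score X N y u}"

end

theory Submission
  imports Defs
begin

text \<open>
  A Borda winner always exists, because the scores have a minimum on the finite set \<open>X\<close>. To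
  realise a given non-empty \<open>S\<close> as the set of winners, rank \<open>S\<close> above its complement and use one
  linear order to break ties inside the two blocks for half of the voters, and the reverse of that
  order for the other half. For two opposite voters, any two alternatives \<open>x \<noteq> y\<close> in the same block
  satisfy: exactly one of the two voters puts \<open>y\<close> above \<open>x\<close>. So the number of block mates placed
  above \<open>x\<close>, counted over both voters, is the size of the block minus 1, independently of \<open>x\<close>.
  Hence all members of \<open>S\<close> tie, and so do all members of the complement, but with a larger score,
  since each of them also has all of \<open>S\<close> above it twice (\<open>opposite_ranks_inside\<close>,
  \<open>opposite_ranks_outside\<close>). An even number of voters splits into such opposite pairs.
\<close>

text \<open>The key \<open>f\<close> is integer-valued so that \<open>- f\<close> reverses the order within both blocks.\<close>

definition block_order :: "'a set \<Rightarrow> 'a set \<Rightarrow> ('a \<Rightarrow> int) \<Rightarrow> 'a rel" where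
  "block_order X S f =
     {(x, y) \<in> X \<times> X. (x \<in> S \<and> y \<notin> S) \<or> ((x \<in> S \<longleftrightarrow> y \<in> S) \<and> f x < f y)}"

lemma block_order_strong:
  assumes "inj_on f X"
  shows "block_order X S f \<in> strong_orderings X"
proof -
  have "total_on X (block_order X S f)"
    using assms by (auto simp: total_on_def block_order_def inj_on_def)
  moreover have "asym (block_order X S f)"
    by (auto simp: asym_on_def block_order_def)
  moreover have "trans (block_order X S f)"
    by (auto simp: trans_def block_order_def)
  ultimately show ?thesis
    by (auto simp: strong_orderings_def block_order_def)
qed

text \<open>
  An alternative of \<open>T\<close> other than \<open>x\<close> is below \<open>x\<close> in exactly one of an order and its reverse.
\<close>

lemma card_below_opposite:
  fixes f :: "'a \<Rightarrow> int"
  assumes "finite T" "inj_on f T" "x \<in> T"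
  shows "card {y \<in> T. f y < f x} + card {y \<in> T. - f y < - f x} + 1 = card T"
proof -
  have "T - {x} = {y \<in> T. f y < f x} \<union> {y \<in> T. - f y < - f x}"
    using assms by (auto simp: inj_on_def) (metis linorder_neqE)
  moreover have "card ({y \<in> T. f y < f x} \<union> {y \<in> T. - f y < - f x})
      = card {y \<in> T. f y < f x} + card {y \<in> T. - f y < - f x}"
    using assms(1) by (intro card_Un_disjoint) auto
  moreover have "card T = card (T - {x}) + 1"
    using card.remove[OF assms(1,3)] by simp
  ultimately show ?thesis by simp
qed

lemma opposite_ranks_inside:
  assumes "finite X" "inj_on f X" "S \<subseteq> X" "x \<in> S"
  shows "(card {y \<in> X. (y, x) \<in> block_order X S f} + 1)
       + (card {y \<in> X. (y, x) \<in> block_order X S (\<lambda>z. - f z)} + 1) = card S + 1"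
proof -
  have "{y \<in> X. (y, x) \<in> block_order X S g} = {y \<in> S. g y < g x}" for g
    using assms by (auto simp: block_order_def)
  moreover have "finite S" "inj_on f S"
    using finite_subset[OF assms(3,1)] inj_on_subset[OF assms(2,3)] by auto
  ultimately show ?thesis
    using card_below_opposite[of S f x] assms(4) by simp
qed

lemma opposite_ranks_outside:
  assumes "finite X" "inj_on f X" "S \<subseteq> X" "x \<in> X - S"
  shows "(card {y \<in> X. (y, x) \<in> block_order X S f} + 1)
       + (card {y \<in> X. (y, x) \<in> block_order X S (\<lambda>z. - f z)} + 1) = card X + card S + 1"
proof -
  have fin: "finite S" "finite (X - S)" and inj: "inj_on f (X - S)"
    using assms(1) finite_subset[OF assms(3)] inj_on_subset[OF assms(2)] by auto
  have "card {y \<in> X. (y, x) \<in> block_order X S g} = card S + card {y \<in> X - S. g y < g x}" for g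
  proof -
    have "{y \<in> X. (y, x) \<in> block_order X S g} = S \<union> {y \<in> X - S. g y < g x}"
      using assms by (auto simp: block_order_def)
    moreover have "card (S \<union> {y \<in> X - S. g y < g x}) = card S + card {y \<in> X - S. g y < g x}"
      using fin by (intro card_Un_disjoint) auto
    ultimately show ?thesis by simp
  qed
  moreover have "card (X - S) + card S = card X"
    using card_Diff_subset[OF fin(1) assms(3)] card_mono[OF assms(1,3)] by simp
  ultimately show ?thesis
    using card_below_opposite[OF fin(2) inj assms(4)] by simp
qed

lemma sum_alternating:
  fixes a b :: nat
  shows "(\<Sum>i = 1..2 * p. if even i then a else b) = p * (a + b)"
  by (induction p) (auto simp: algebra_simps)

theorem mainTheorem3:
  fixes X :: "'a set" and N :: "nat set" and m n :: nat
  assumes "finite X" and "card X = m" and "m \<ge> 3"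
    and "N = {1..n}" and "n \<ge> 2" and "even n"
  shows "correspondence_range X N (borda X N) = {S. S \<subseteq> X \<and> S \<noteq> {}}"
proof (intro equalityI subsetI)
  fix S assume "S \<in> correspondence_range X N (borda X N)"
  then obtain u where S: "S = borda X N u"
    by (auto simp: correspondence_range_def)
  have "X \<noteq> {}" using assms by auto
  then obtain x where "is_arg_min (\<lambda>x. borda_score X N x u) (\<lambda>x. x \<in> X) x"
    using ex_is_arg_min_if_finite[OF assms(1)] by blast
  then have "x \<in> borda X N u"
    by (auto simp: borda_def is_arg_min_linorder)
  then show "S \<in> {S. S \<subseteq> X \<and> S \<noteq> {}}"
    using S by (auto simp: borda_def)
next
  fix S assume "S \<in> {S. S \<subseteq> X \<and> S \<noteq> {}}"
  then have SX: "S \<subseteq> X" and "S \<noteq> {}" by auto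
  then obtain s where s: "s \<in> S" by auto
  obtain p where p: "n = 2 * p" "p > 0"
    using assms by (auto elim: evenE)
  obtain h :: "'a \<Rightarrow> nat" where "inj_on h X"
    using finite_imp_inj_to_nat_seg[OF assms(1)] by blast
  define f :: "'a \<Rightarrow> int" where "f = (\<lambda>x. int (h x))"
  have inj: "inj_on f X" "inj_on (\<lambda>z. - f z) X"
    using \<open>inj_on h X\<close> by (auto simp: f_def inj_on_def)
  define u where "u = restrict
    (\<lambda>i. if even i then block_order X S f else block_order X S (\<lambda>z. - f z)) N"
  have prof: "u \<in> profiles X N"
    using inj by (auto simp: u_def profiles_def intro!: block_order_strong)
  have score: "borda_score X N x u = p *
      ((card {y \<in> X. (y, x) \<in> block_order X S f} + 1)
     + (card {y \<in> X. (y, x) \<in> block_order X S (\<lambda>z. - f z)} + 1))" for x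
  proof -
    have "borda_score X N x u = (\<Sum>i = 1..2 * p. if even i
        then card {y \<in> X. (y, x) \<in> block_order X S f} + 1
        else card {y \<in> X. (y, x) \<in> block_order X S (\<lambda>z. - f z)} + 1)"
      unfolding borda_score_def assms(4) p(1)
      by (rule sum.cong) (auto simp: position_def u_def assms(4) p(1))
    then show ?thesis by (simp only: sum_alternating)
  qed
  have inside: "borda_score X N x u = p * (card S + 1)" if "x \<in> S" for x
    unfolding score opposite_ranks_inside[OF assms(1) inj(1) SX that] ..
  have outside: "borda_score X N x u = p * (card X + card S + 1)" if "x \<in> X - S" for x
    unfolding score opposite_ranks_outside[OF assms(1) inj(1) SX that] ..
  have gap: "p * (card S + 1) < p * (card X + card S + 1)"
    using p assms by simp
  have "borda X N u = S"
  proof (intro equalityI subsetI)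
    fix x assume x: "x \<in> borda X N u"
    then have "x \<in> X" "borda_score X N x u \<le> borda_score X N s u"
      using s SX by (auto simp: borda_def)
    then show "x \<in> S"
      using inside[OF s] outside[of x] gap by (metis DiffI not_le)
  next
    fix x assume x: "x \<in> S"
    have "borda_score X N x u \<le> borda_score X N y u" if "y \<in> X" for y
      using inside[OF x] inside[of y] outside[of y] gap that by (cases "y \<in> S") auto
    then show "x \<in> borda X N u"
      using x SX by (auto simp: borda_def)
  qed
  then show "S \<in> correspondence_range X N (borda X N)"
    using prof by (auto simp: correspondence_range_def)
qed

end
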